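(* Let $w=(w(n))_{n\in\mathbb{N}}$ be a nonnegative weight sequence and $0<p<\infty$. The sequence Lorentz space $\gamma_{p,w}$ is strictly monotone if and only if $W(\infty)=\infty$.
   Context: $\mathbb{N}$ is the set of positive integers and $\ell^0$ is the set of all real sequences. For $x\in\ell^0$ put $d_x(\lambda)=\operatorname{card}\{k\in\mathbb{N}:|x(k)|>\lambda\}$ for $\lambda\ge 0$, $x^*(n)=\inf\{\lambda\ge 0: d_x(\lambda)\le n-1\}$ (decreasing rearrangement) and $x^{**}(n)=\frac1n\sum_{i=1}^n x^*(i)$ for $n\in\mathbb{N}$. Weight sequences: for the given $0<p<\infty$, a nonnegative weight sequence is a sequence $w=(w(n))_{n\in\mathbb{N}}$ of nonnegative reals, with $w(n)>0$ for at least one $n$, such that $W_p(n)=n^p\sum_{i=n+1}^\infty \frac{w(i)}{i^p}<\infty$ for every $n\in\mathbb{N}$. Put $W(n)=\sum_{i=1}^n w(i)$ and $W(\infty)=\sum_{i=1}^\infty w(i)\in(0,\infty]$. The sequence Lorentz space $\gamma_{p,w}$ is the space of all $x\in\ell^0$ with $\|x\|_{\gamma_{p,w}}=\left(\sum_{n=1}^\infty (x^{**}(n))^p w(n)\right)^{1/p}<\infty$; it is a quasi-Banach space under this quasi-norm. A quasi-Banach sequence space $E$ is strictly monotone if for all nonnegative $x,y\in E$ with $x\le y$ (coordinatewise) and $x\ne y$ one has $\|x\|_E<\|y\|_E$. *)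

theory Defs
  imports Complex_Main "HOL-Library.Extended_Nat" "HOL-Library.Extended_Nonnegative_Real"
begin

text \<open>
  Sequences are indexed by the positive integers and represented by functions
  \<open>nat \<Rightarrow> real\<close>. For the elements of the space of all real sequences the unused value
  at \<open>0\<close> is normalised to \<open>0\<close>, so that HOL equality and the pointwise order of functions
  are equality and the coordinatewise order of sequences. For weight sequences the value
  at \<open>0\<close> is never used.
\<close>

definition l0 :: "(nat \<Rightarrow> real) set" where
  "l0 = {x. x 0 = 0}"

text \<open>The count may be infinite (and \<open>card\<close> of an infinite set is \<open>0\<close>), hence the type \<open>enat\<close>.\<close>

definition distrib :: "(nat \<Rightarrow> real) \<Rightarrow> real \<Rightarrow> enat" where
  "distrib x t =
     (let A = {k. k \<ge> 1 \<and> \<bar>x k\<bar> > t} in if finite A then enat (card A) else \<infinity>)"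

text \<open>
  The infimum is taken in \<open>ennreal\<close>, so that the rearrangement of an unbounded sequence is
  \<open>\<infinity>\<close> (the infimum of the empty set).
\<close>

definition rearr :: "(nat \<Rightarrow> real) \<Rightarrow> nat \<Rightarrow> ennreal" where
  "rearr x n = Inf {ennreal t | t. t \<ge> 0 \<and> distrib x t \<le> enat (n - 1)}"

definition max_rearr :: "(nat \<Rightarrow> real) \<Rightarrow> nat \<Rightarrow> ennreal" where
  "max_rearr x n = (\<Sum>i = 1..n. rearr x i) / of_nat n"

text \<open>The power \<open>a\<^sup>r\<close> for \<open>a \<in> [0,\<infinity>]\<close>; it is used for \<open>r > 0\<close> only.\<close>

definition ennpowr :: "ennreal \<Rightarrow> real \<Rightarrow> ennreal" where
  "ennpowr a r = (if a = \<infinity> then \<infinity> else ennreal (enn2real a powr r))"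

definition W_p :: "real \<Rightarrow> (nat \<Rightarrow> real) \<Rightarrow> nat \<Rightarrow> ennreal" where
  "W_p p w n =
     ennreal (real n powr p) * (\<Sum>i. ennreal (w (n + 1 + i) / real (n + 1 + i) powr p))"

definition weight_seq :: "real \<Rightarrow> (nat \<Rightarrow> real) \<Rightarrow> bool" where
  "weight_seq p w \<longleftrightarrow>
     (\<forall>n\<ge>1. w n \<ge> 0) \<and> (\<exists>n\<ge>1. w n > 0) \<and> (\<forall>n\<ge>1. W_p p w n < \<infinity>)"

definition W_infinity :: "(nat \<Rightarrow> real) \<Rightarrow> ennreal" where
  "W_infinity w = (\<Sum>i. ennreal (w (Suc i)))"

definition gamma_norm :: "real \<Rightarrow> (nat \<Rightarrow> real) \<Rightarrow> (nat \<Rightarrow> real) \<Rightarrow> ennreal" where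
  "gamma_norm p w x =
     ennpowr (\<Sum>n. ennpowr (max_rearr x (Suc n)) p * ennreal (w (Suc n))) (1 / p)"

definition gamma_space :: "real \<Rightarrow> (nat \<Rightarrow> real) \<Rightarrow> (nat \<Rightarrow> real) set" where
  "gamma_space p w = {x \<in> l0. gamma_norm p w x < \<infinity>}"

definition strictly_monotone ::
  "(nat \<Rightarrow> real) set \<Rightarrow> ((nat \<Rightarrow> real) \<Rightarrow> ennreal) \<Rightarrow> bool" where
  "strictly_monotone E N \<longleftrightarrow>
     (\<forall>x\<in>E. \<forall>y\<in>E. (\<forall>k. 0 \<le> x k) \<longrightarrow> (\<forall>k. 0 \<le> y k) \<longrightarrow> x \<le> y \<longrightarrow> x \<noteq> y \<longrightarrow> N x < N y)"

end

theory Submission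
  imports Defs
begin

text \<open>
  If \<open>W(\<infinity>) < \<infinity>\<close>, then the constant sequence \<open>1\<close> belongs to the space. Setting one of its
  entries to \<open>0\<close> leaves infinitely many entries \<open>1\<close>, hence changes neither the rearrangement nor
  the quasi-norm, and strict monotonicity fails.

  Let \<open>W(\<infinity>) = \<infinity>\<close>. A sequence with infinitely many entries above some \<open>c > 0\<close> has \<open>y\<^sup>*\<^sup>* \<ge> c\<close>
  everywhere and so infinite quasi-norm (\<open>gamma_norm_infinite\<close>). Hence an element \<open>y\<close> of the space
  has finite superlevel sets, and lowering a single entry is visible in the rearrangement: if
  \<open>0 \<le> x \<le> y\<close> and \<open>x k < y k = l\<close>, then \<open>{x \<ge> l}\<close> has fewer elements than \<open>{y \<ge> l}\<close>, so that
  \<open>x\<^sup>*(m) < l \<le> y\<^sup>*(m)\<close> for \<open>m = card {y \<ge> l}\<close> (\<open>rearr_less_of_finite_superlevel\<close>). As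
  \<open>x\<^sup>* \<le> y\<^sup>*\<close> everywhere, \<open>x\<^sup>*\<^sup>*(n) < y\<^sup>*\<^sup>*(n)\<close> for all \<open>n \<ge> m\<close>. A positive weight \<open>w n\<close>
  with \<open>n \<ge> m\<close> exists because \<open>W(\<infinity>) = \<infinity>\<close>, and it makes the sums defining the
  quasi-norms differ. The averaging in \<open>x\<^sup>*\<^sup>*\<close> is essential here: it carries the strict inequality
  from the single index \<open>m\<close> to all later ones, whatever zeros the weight has.
\<close>

section \<open>Sums and powers of extended nonnegative reals\<close>

lemma ennreal_add_less_le_mono:
  fixes a b c d :: ennreal
  assumes "a < b" "c \<le> d" "c < \<infinity>"
  shows "a + c < b + d"
proof -
  have "a + c < b + c"
    using assms by (simp add: add.commute[of _ c] ennreal_add_left_cancel_less less_top)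
  also have "\<dots> \<le> b + d"
    using assms by (simp add: add_left_mono)
  finally show ?thesis .
qed

lemma ennreal_suminf_strict_mono:
  fixes f g :: "nat \<Rightarrow> ennreal"
  assumes le: "\<And>i. f i \<le> g i" and less: "f m < g m" and fin: "(\<Sum>i. f i) < \<infinity>"
  shows "(\<Sum>i. f i) < (\<Sum>i. g i)"
proof -
  have "(\<Sum>i. f i) = (\<Sum>i<Suc m. f i) + (\<Sum>i. f (i + Suc m))"
    using suminf_offset[of f "Suc m"] by (simp add: add.commute)
  then have fin': "(\<Sum>i<m. f i) < \<infinity>" "(\<Sum>i. f (i + Suc m)) < \<infinity>"
    using fin by (auto simp: ennreal_add_eq_top less_top)
  have "(\<Sum>i. f i) = f m + ((\<Sum>i<m. f i) + (\<Sum>i. f (i + Suc m)))"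
    using suminf_offset[of f "Suc m"] by (simp add: algebra_simps)
  also have "\<dots> < g m + ((\<Sum>i<m. g i) + (\<Sum>i. g (i + Suc m)))"
    using fin' by (intro ennreal_add_less_le_mono less add_mono sum_mono suminf_le le summableI)
      (auto simp: ennreal_add_eq_top less_top)
  also have "\<dots> = (\<Sum>i. g i)"
    using suminf_offset[of g "Suc m"] by (simp add: algebra_simps)
  finally show ?thesis .
qed

lemma ennreal_sum_strict_mono:
  fixes f g :: "'a \<Rightarrow> ennreal"
  assumes "finite A" "m \<in> A" "\<And>i. i \<in> A \<Longrightarrow> f i \<le> g i" "f m < g m" "\<And>i. i \<in> A \<Longrightarrow> f i < \<infinity>"
  shows "sum f A < sum g A"
proof -
  have "sum f A = f m + sum f (A - {m})" "sum g A = g m + sum g (A - {m})"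
    using assms by (auto simp: sum.remove)
  moreover have "sum f (A - {m}) < \<infinity>"
    using assms by (simp add: less_top)
  ultimately show ?thesis
    using assms by (auto intro!: ennreal_add_less_le_mono sum_mono)
qed

lemma ennpowr_strict_mono:
  assumes "a < b" "0 < r"
  shows "ennpowr a r < ennpowr b r"
  using assms
  by (cases a; cases b) (auto simp: ennpowr_def ennreal_less_iff intro!: powr_less_mono2)

lemma ennpowr_mono: "a \<le> b \<Longrightarrow> 0 < r \<Longrightarrow> ennpowr a r \<le> ennpowr b r"
  using ennpowr_strict_mono[of a b r] by (cases "a = b") (auto simp: less_le)

lemma ennpowr_less_infinity_iff: "ennpowr a r < \<infinity> \<longleftrightarrow> a < \<infinity>"
  by (auto simp: ennpowr_def less_top)

section \<open>The rearrangement and its averages\<close>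

lemma rearr_ge:
  assumes "1 \<le> n" "finite A" "n \<le> card A" "\<And>k. k \<in> A \<Longrightarrow> 1 \<le> k" "\<And>k. k \<in> A \<Longrightarrow> c \<le> \<bar>x k\<bar>"
  shows "ennreal c \<le> rearr x n"
  unfolding rearr_def
proof (rule Inf_greatest, clarify)
  fix t :: real assume t: "0 \<le> t" "distrib x t \<le> enat (n - 1)"
  let ?B = "{k. k \<ge> 1 \<and> \<bar>x k\<bar> > t}"
  have B: "finite ?B" "card ?B \<le> n - 1"
    using t by (auto simp: distrib_def Let_def split: if_splits)
  show "ennreal c \<le> ennreal t"
  proof (rule ccontr)
    assume "\<not> ennreal c \<le> ennreal t"
    then have "t < c" by (meson ennreal_leI not_le)
    then have "A \<subseteq> ?B" using assms by fastforce
    then have "card A \<le> card ?B" using B by (simp add: card_mono)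
    then show False using assms B by linarith
  qed
qed

lemma rearr_le:
  assumes "0 \<le> t" "finite {k. 1 \<le> k \<and> t < \<bar>x k\<bar>}" "card {k. 1 \<le> k \<and> t < \<bar>x k\<bar>} \<le> n - 1"
  shows "rearr x n \<le> ennreal t"
  unfolding rearr_def using assms by (intro Inf_lower) (auto simp: distrib_def Let_def)

lemma rearr_mono:
  assumes "\<And>k. \<bar>x k\<bar> \<le> \<bar>y k\<bar>"
  shows "rearr x n \<le> rearr y n"
proof -
  have "distrib x t \<le> distrib y t" for t
  proof -
    have sub: "{k. k \<ge> 1 \<and> \<bar>x k\<bar> > t} \<subseteq> {k. k \<ge> 1 \<and> \<bar>y k\<bar> > t}"
      using assms by (auto intro: less_le_trans)
    show ?thesis
      using finite_subset[OF sub] card_mono[OF _ sub] by (auto simp: distrib_def Let_def)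
  qed
  then show ?thesis
    unfolding rearr_def by (intro Inf_superset_mono) (auto intro: order_trans)
qed

lemma rearr_ge_of_infinite:
  assumes "infinite {k. 1 \<le> k \<and> c \<le> \<bar>x k\<bar>}" "1 \<le> n"
  shows "ennreal c \<le> rearr x n"
proof -
  obtain A where "finite A" "card A = n" "A \<subseteq> {k. 1 \<le> k \<and> c \<le> \<bar>x k\<bar>}"
    using infinite_arbitrarily_large[OF assms(1)] by blast
  then show ?thesis
    using assms(2) by (intro rearr_ge[of n A]) auto
qed

text \<open>
  A single lowered entry is seen by the rearrangement at the position \<open>m = card {\<bar>y\<bar> \<ge> \<bar>y k\<bar>}\<close>. Finiteness
  of the superlevel sets of \<open>y\<close> is used twice: it makes this position a natural number, and it
  separates the values of \<open>\<bar>x\<bar>\<close> below \<open>\<bar>y k\<bar>\<close> from \<open>\<bar>y k\<bar>\<close> by a gap, without which only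
  \<open>x\<^sup>*(m) \<le> \<bar>y k\<bar>\<close> would follow.
\<close>

lemma rearr_less_of_finite_superlevel:
  assumes le: "\<And>j. \<bar>x j\<bar> \<le> \<bar>y j\<bar>" and k: "1 \<le> k" "\<bar>x k\<bar> < \<bar>y k\<bar>"
    and fin: "\<And>c. 0 < c \<Longrightarrow> finite {j. 1 \<le> j \<and> c \<le> \<bar>y j\<bar>}"
  obtains m where "1 \<le> m" "rearr x m < rearr y m"
proof
  define l where "l = \<bar>y k\<bar>"
  define Y where "Y = {j. 1 \<le> j \<and> l \<le> \<bar>y j\<bar>}"
  define X where "X = {j. 1 \<le> j \<and> l \<le> \<bar>x j\<bar>}"
  have l: "0 < l" using k by (auto simp: l_def)
  have Y: "finite Y" "k \<in> Y" using fin[OF l] k by (auto simp: Y_def l_def)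
  have "X \<subseteq> Y" using le by (auto simp: X_def Y_def intro: order_trans)
  moreover have "k \<notin> X" using k by (simp add: X_def l_def)
  ultimately have "X \<subset> Y" using Y(2) by blast
  then have cardX: "card X < card Y" using Y(1) by (simp add: psubset_card_mono)
  show "1 \<le> card Y" using cardX by simp
  have yge: "ennreal l \<le> rearr y (card Y)"
    using Y cardX by (intro rearr_ge[of _ Y]) (auto simp: Y_def)
  \<comment> \<open>\<open>t\<close> is the largest value of \<open>\<bar>x\<bar>\<close> in \<open>[l/2, l)\<close>, or \<open>l/2\<close> if there is none.\<close>
  define S where "S = insert (l/2) ((\<lambda>j. \<bar>x j\<bar>) ` {j. 1 \<le> j \<and> l/2 \<le> \<bar>x j\<bar> \<and> \<bar>x j\<bar> < l})"
  define t where "t = Max S"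
  have "finite {j. 1 \<le> j \<and> l/2 \<le> \<bar>x j\<bar> \<and> \<bar>x j\<bar> < l}"
    by (rule finite_subset[OF _ fin[of "l/2"]]) (use l le in \<open>auto intro: order_trans\<close>)
  then have S: "finite S" "S \<noteq> {}" by (auto simp: S_def)
  have t_in: "t \<in> S" and t_ge: "\<And>s. s \<in> S \<Longrightarrow> s \<le> t"
    using S by (auto simp: t_def)
  have t: "0 \<le> t" "t < l" "l/2 \<le> t"
    using t_in l t_ge[of "l/2"] by (auto simp: S_def)
  have "{j. 1 \<le> j \<and> t < \<bar>x j\<bar>} \<subseteq> X"
  proof clarify
    fix j assume j: "1 \<le> j" "t < \<bar>x j\<bar>"
    have "\<bar>x j\<bar> \<notin> S" using t_ge j(2) by fastforce
    then show "j \<in> X" using j t(3) by (auto simp: S_def X_def)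
  qed
  moreover have "finite X" using \<open>X \<subset> Y\<close> Y(1) finite_subset by blast
  ultimately have "finite {j. 1 \<le> j \<and> t < \<bar>x j\<bar>}" "card {j. 1 \<le> j \<and> t < \<bar>x j\<bar>} \<le> card X"
    by (rule finite_subset, rule card_mono[rotated])
  then have "rearr x (card Y) \<le> ennreal t"
    using t cardX by (intro rearr_le) linarith+
  also have "\<dots> < ennreal l" using t by (simp add: ennreal_less_iff)
  finally show "rearr x (card Y) < rearr y (card Y)" using yge by simp
qed

lemma max_rearr_mono:
  "(\<And>i. i \<ge> 1 \<Longrightarrow> rearr x i \<le> rearr y i) \<Longrightarrow> max_rearr x n \<le> max_rearr y n"
  unfolding max_rearr_def by (intro divide_right_mono_ennreal sum_mono) auto

lemma max_rearr_strict_mono: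
  assumes le: "\<And>i. rearr x i \<le> rearr y i" and m: "1 \<le> m" "m \<le> n" "rearr x m < rearr y m"
    and fin: "max_rearr x n < \<infinity>"
  shows "max_rearr x n < max_rearr y n"
proof -
  have n: "(of_nat n :: ennreal) \<noteq> 0" using m by auto
  have times: "max_rearr z n * of_nat n = (\<Sum>i = 1..n. rearr z i)" for z
    using n unfolding max_rearr_def
    by (simp only: ennreal_divide_times ennreal_divide_self of_nat_less_top mult_1_right not_False_eq_True)
  have "(\<Sum>i = 1..n. rearr x i) < \<infinity>"
    using fin n unfolding times[symmetric] by (simp add: ennreal_mult_less_top of_nat_less_top)
  then have "rearr x i < \<infinity>" if "i \<in> {1..n}" for i
    using that by (auto simp: less_top)
  then have "(\<Sum>i = 1..n. rearr x i) < (\<Sum>i = 1..n. rearr y i)"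
    using m le by (intro ennreal_sum_strict_mono[of _ m]) auto
  then show ?thesis
    unfolding times[symmetric] by (meson mult_right_mono not_le zero_le)
qed

lemma max_rearr_const:
  assumes "1 \<le> n" "\<And>i. 1 \<le> i \<Longrightarrow> rearr x i = c"
  shows "max_rearr x n = c"
  using assms unfolding max_rearr_def
  by (simp add: mult.commute[of "of_nat n"] ennreal_mult_divide_eq)

lemma max_rearr_ge:
  assumes "1 \<le> n" "\<And>i. 1 \<le> i \<Longrightarrow> c \<le> rearr x i"
  shows "c \<le> max_rearr x n"
proof -
  have "c = (\<Sum>i = 1..n. c) / of_nat n"
    using assms by (simp add: mult.commute[of "of_nat n"] ennreal_mult_divide_eq)
  also have "\<dots> \<le> max_rearr x n"
    unfolding max_rearr_def using assms by (intro divide_right_mono_ennreal sum_mono) auto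
  finally show ?thesis .
qed

section \<open>The quasi-norm\<close>

text \<open>
  Infinitely many entries of the maximal modulus \<open>1\<close> force the rearrangement to be constantly \<open>1\<close>,
  so the remaining entries are invisible to the quasi-norm.
\<close>

lemma gamma_norm_const:
  assumes "infinite {k. 1 \<le> k \<and> 1 \<le> \<bar>x k\<bar>}" "\<And>k. \<bar>x k\<bar> \<le> 1"
  shows "gamma_norm p w x = ennpowr (W_infinity w) (1 / p)"
proof -
  have "rearr x i = 1" if "1 \<le> i" for i
  proof (rule antisym)
    have "{k. 1 \<le> k \<and> 1 < \<bar>x k\<bar>} = {}" using assms(2) by (auto simp: not_less)
    then have "rearr x i \<le> ennreal 1" by (intro rearr_le) (simp_all only: card.empty finite.emptyI)
    then show "rearr x i \<le> 1" by simp
    show "1 \<le> rearr x i" using rearr_ge_of_infinite[OF assms(1) that] by simp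
  qed
  then have "max_rearr x (Suc n) = 1" for n by (intro max_rearr_const) auto
  then show ?thesis by (simp add: gamma_norm_def W_infinity_def ennpowr_def)
qed

lemma gamma_norm_infinite:
  assumes W: "W_infinity w = \<infinity>" and "0 < p" "0 < c" and inf: "infinite {k. 1 \<le> k \<and> c \<le> \<bar>x k\<bar>}"
  shows "gamma_norm p w x = \<infinity>"
proof -
  have "\<infinity> = ennpowr (ennreal c) p * W_infinity w"
    using W \<open>0 < c\<close> by (simp add: ennpowr_def ennreal_mult_top)
  also have "\<dots> = (\<Sum>n. ennpowr (ennreal c) p * ennreal (w (Suc n)))"
    by (simp add: W_infinity_def)
  also have "\<dots> \<le> (\<Sum>n. ennpowr (max_rearr x (Suc n)) p * ennreal (w (Suc n)))"
    using rearr_ge_of_infinite[OF inf] \<open>0 < p\<close>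
    by (intro suminf_le mult_right_mono ennpowr_mono max_rearr_ge summableI) auto
  finally show ?thesis
    by (simp add: gamma_norm_def ennpowr_def top_unique)
qed

text \<open>
  Only finitely many positive weights would give a finite total, so positive weights occur beyond
  every index.
\<close>

lemma W_infinity_positive_weight:
  assumes "W_infinity w = \<infinity>"
  obtains n where "m \<le> n" "0 < w (Suc n)"
proof (rule ccontr)
  assume "\<not> thesis"
  then have "ennreal (w (Suc n)) = 0" if "m \<le> n" for n
    using \<open>\<not> thesis\<close> \<open>\<And>n. m \<le> n \<Longrightarrow> 0 < w (Suc n) \<Longrightarrow> thesis\<close> that
    by (meson ennreal_neg not_le)
  then have "W_infinity w = (\<Sum>n<m. ennreal (w (Suc n)))"
    unfolding W_infinity_def by (intro suminf_finite) (auto simp: not_less)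
  then show False using assms ennreal_sum_less_top[of "{..<m}" "\<lambda>n. ennreal (w (Suc n))"] by simp
qed

lemma gamma_norm_strict_mono:
  assumes "0 < p" and W: "W_infinity w = \<infinity>" and norm: "gamma_norm p w x < \<infinity>"
    and le: "\<And>i. rearr x i \<le> rearr y i" and m: "1 \<le> m" "rearr x m < rearr y m"
  shows "gamma_norm p w x < gamma_norm p w y"
proof -
  obtain n where n: "m \<le> n" "0 < w (Suc n)"
    using W_infinity_positive_weight[OF W] by blast
  let ?f = "\<lambda>z n. ennpowr (max_rearr z (Suc n)) p * ennreal (w (Suc n))"
  have sum_fin: "(\<Sum>n. ?f x n) < \<infinity>"
    using norm by (simp only: gamma_norm_def ennpowr_less_infinity_iff)
  then have "?f x n < \<infinity>"
    using ennreal_suminf_lessD by blast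
  then have "max_rearr x (Suc n) < \<infinity>"
    using n by (subst ennpowr_less_infinity_iff[of _ p, symmetric]) (auto simp: ennreal_mult_less_top)
  then have "max_rearr x (Suc n) < max_rearr y (Suc n)"
    using m n le by (intro max_rearr_strict_mono) auto
  then have "?f x n < ?f y n"
    using n \<open>0 < p\<close> by (intro ennreal_mult_strict_right_mono ennpowr_strict_mono) auto
  moreover have "?f x i \<le> ?f y i" for i
    using le \<open>0 < p\<close> by (intro mult_right_mono ennpowr_mono max_rearr_mono) auto
  ultimately have "(\<Sum>n. ?f x n) < (\<Sum>n. ?f y n)"
    by (intro ennreal_suminf_strict_mono[of _ _ n] sum_fin)
  then show ?thesis
    unfolding gamma_norm_def using \<open>0 < p\<close> by (intro ennpowr_strict_mono) auto
qed

section \<open>Strict monotonicity\<close>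

theorem theorem4p4:
  fixes p :: real and w :: "nat \<Rightarrow> real"
  assumes "0 < p" and "weight_seq p w"
  shows "strictly_monotone (gamma_space p w) (gamma_norm p w) \<longleftrightarrow> W_infinity w = \<infinity>"
proof
  assume sm: "strictly_monotone (gamma_space p w) (gamma_norm p w)"
  show "W_infinity w = \<infinity>"
  proof (rule ccontr)
    assume "W_infinity w \<noteq> \<infinity>"
    then have fin: "ennpowr (W_infinity w) (1 / p) < \<infinity>"
      by (simp only: ennpowr_less_infinity_iff) (simp add: less_top)
    define x y :: "nat \<Rightarrow> real"
      where "x = (\<lambda>k. if 2 \<le> k then 1 else 0)" and "y = (\<lambda>k. if 1 \<le> k then 1 else 0)"
    have norm: "gamma_norm p w z = ennpowr (W_infinity w) (1 / p)" if "z = x \<or> z = y" for z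
    proof (rule gamma_norm_const)
      have "{2..} \<subseteq> {k. 1 \<le> k \<and> 1 \<le> \<bar>z k\<bar>}" using that by (auto simp: x_def y_def)
      then show "infinite {k. 1 \<le> k \<and> 1 \<le> \<bar>z k\<bar>}" using infinite_Ici infinite_super by blast
    qed (use that in \<open>auto simp: x_def y_def\<close>)
    have "x \<in> gamma_space p w" "y \<in> gamma_space p w"
      using fin norm by (auto simp: gamma_space_def l0_def) (auto simp: x_def y_def)
    moreover have "x \<le> y" "\<And>k. 0 \<le> x k" "\<And>k. 0 \<le> y k" by (auto simp: x_def y_def le_fun_def)
    moreover have "x 1 \<noteq> y 1" by (simp add: x_def y_def)
    ultimately have "gamma_norm p w x < gamma_norm p w y"
      using sm unfolding strictly_monotone_def by metis
    then show False using norm by simp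
  qed
next
  assume W: "W_infinity w = \<infinity>"
  show "strictly_monotone (gamma_space p w) (gamma_norm p w)"
    unfolding strictly_monotone_def
  proof (intro ballI impI)
    fix x y
    assume xy: "x \<in> gamma_space p w" "y \<in> gamma_space p w"
      and nonneg: "\<forall>k. 0 \<le> x k" "\<forall>k. 0 \<le> y k" and "x \<le> y" "x \<noteq> y"
    have le: "\<bar>x k\<bar> \<le> \<bar>y k\<bar>" for k
      using nonneg \<open>x \<le> y\<close> by (simp add: le_fun_def)
    obtain k where "x k \<noteq> y k" using \<open>x \<noteq> y\<close> by blast
    then have k: "1 \<le> k" "\<bar>x k\<bar> < \<bar>y k\<bar>"
      using xy nonneg le[of k] by (auto simp: gamma_space_def l0_def Suc_le_eq intro: gr0I)
    have "finite {j. 1 \<le> j \<and> c \<le> \<bar>y j\<bar>}" if "0 < c" for c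
      using gamma_norm_infinite[OF W \<open>0 < p\<close> that, of y] xy(2)
      by (cases "finite {j. 1 \<le> j \<and> c \<le> \<bar>y j\<bar>}") (simp_all add: gamma_space_def)
    then obtain m where "1 \<le> m" "rearr x m < rearr y m"
      using rearr_less_of_finite_superlevel[where x = x and y = y and k = k] le k by metis
    then show "gamma_norm p w x < gamma_norm p w y"
      using xy \<open>0 < p\<close> W rearr_mono[of x y] le
      by (intro gamma_norm_strict_mono) (auto simp: gamma_space_def)
  qed
qed

end
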